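(* Let $L$ be a complete multiplicative lattice. We have: (a) $x^{(n)}\leqslant y\Rightarrow x\leqslant y_{(n)}$ for every $x,y\in L$ and every natural $n$; in particular, $\mathrm{solv}(y)\leqslant\mathrm{Solv}(y)$ for every $y\in L$. (b) Suppose $L$ is algebraic and distributive, and satisfies the weak Kaplansky condition. Then, for every $y\in L$, $$\mathrm{Solv}(y)=\mathrm{solv}(y)=\mathrm{loc.solv}(y)=\sqrt{y}.$$
   Context: A complete multiplicative lattice is a complete lattice $L$ (smallest element $0$, largest element $1$) equipped with a binary multiplication satisfying $xy\leqslant x\wedge y$ for all $x,y\in L$; nothing else is assumed about the multiplication in general. $L$ is distributive if $x(y\vee z)=xy\vee xz$ and $(x\vee y)z=xz\vee yz$ for all $x,y,z\in L$. Write $x^2=xx$. An element $p\neq 1$ of $L$ is prime if for all $x,y\in L$, $xy\leqslant p$ implies $x\leqslant p$ or $y\leqslant p$. An element of $L$ is radical if it is a meet of a (possibly empty) set of prime elements; $\sqrt{x}$ is the smallest radical element $r$ with $x\leqslant r$. An element $x$ of a complete lattice is compact if every subset $S$ with $x\leqslant\bigvee S$ has a finite subset $F$ with $x\leqslant\bigvee F$; the lattice is algebraic if every element is a join of compact elements. Weak Kaplansky condition: whenever $x\in L$ is compact, so is $x^2$. Derived series: $x^{(0)}=x$, $x^{(n+1)}=(x^{(n)})^2$. $x$ is $y$-solvable if $x^{(n)}\leqslant y$ for some natural $n$; $\mathrm{solv}(y)$ is the join of all $y$-solvable elements. $x$ is locally $y$-solvable if, for every infinite sequence $c_0,c_1,\ldots$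 of compact elements with $c_0\leqslant x$ and $c_{n+1}\leqslant c_n^2$ for all $n$, there exists $n$ with $c_n\leqslant y$; $\mathrm{loc.solv}(y)$ is the join of all locally $y$-solvable elements. For $x\in L$ define a transfinite sequence by $x_{(0)}=x$, $x_{(\alpha+1)}=\bigvee\{y\in L\mid y^2\leqslant x_{(\alpha)}\}$, and $x_{(\lambda)}=\bigvee_{\alpha<\lambda}x_{(\alpha)}$ for limit ordinals $\lambda$; $\mathrm{Solv}(x)$ is the join of this transfinite sequence over all ordinals. *)

theory Defs
  imports Main
begin

class complete_mult_lattice = complete_lattice + times +
  assumes mult_le_inf: "x * y \<le> inf x y"


definition mult_distributive :: "'a::complete_mult_lattice itself \<Rightarrow> bool" where
  "mult_distributive _ \<longleftrightarrow>
     (\<forall>x y z :: 'a. x * sup y z = sup (x * y) (x * z) \<and> sup x y * z = sup (x * z) (y * z))"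

definition prime_element :: "'a::complete_mult_lattice \<Rightarrow> bool" where
  "prime_element p \<longleftrightarrow> p \<noteq> top \<and> (\<forall>x y. x * y \<le> p \<longrightarrow> x \<le> p \<or> y \<le> p)"

definition radical_element :: "'a::complete_mult_lattice \<Rightarrow> bool" where
  "radical_element r \<longleftrightarrow> (\<exists>P. (\<forall>p\<in>P. prime_element p) \<and> r = Inf P)"

definition radical :: "'a::complete_mult_lattice \<Rightarrow> 'a" where
  "radical x = (LEAST r. radical_element r \<and> x \<le> r)"

definition compact_element :: "'a::complete_lattice \<Rightarrow> bool" where
  "compact_element x \<longleftrightarrow> (\<forall>S. x \<le> Sup S \<longrightarrow> (\<exists>F\<subseteq>S. finite F \<and> x \<le> Sup F))"

definition algebraic_lattice :: "'a::complete_lattice itself \<Rightarrow> bool" where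
  "algebraic_lattice _ \<longleftrightarrow> (\<forall>x :: 'a. \<exists>K. (\<forall>k\<in>K. compact_element k) \<and> x = Sup K)"

definition weak_Kaplansky :: "'a::complete_mult_lattice itself \<Rightarrow> bool" where
  "weak_Kaplansky _ \<longleftrightarrow> (\<forall>x :: 'a. compact_element x \<longrightarrow> compact_element (x * x))"


primrec derived :: "'a::complete_mult_lattice \<Rightarrow> nat \<Rightarrow> 'a" where
  "derived x 0 = x"
| "derived x (Suc n) = derived x n * derived x n"

definition solvable :: "'a::complete_mult_lattice \<Rightarrow> 'a \<Rightarrow> bool" where
  "solvable y x \<longleftrightarrow> (\<exists>n. derived x n \<le> y)"

definition solv :: "'a::complete_mult_lattice \<Rightarrow> 'a" where
  "solv y = Sup {x. solvable y x}"

definition locally_solvable :: "'a::complete_mult_lattice \<Rightarrow> 'a \<Rightarrow> bool" where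
  "locally_solvable y x \<longleftrightarrow>
     (\<forall>c :: nat \<Rightarrow> 'a.
        (\<forall>n. compact_element (c n)) \<and> c 0 \<le> x \<and> (\<forall>n. c (Suc n) \<le> c n * c n)
        \<longrightarrow> (\<exists>n. c n \<le> y))"

definition loc_solv :: "'a::complete_mult_lattice \<Rightarrow> 'a" where
  "loc_solv y = Sup {x. locally_solvable y x}"


definition sqrt_step :: "'a::complete_mult_lattice \<Rightarrow> 'a" where
  "sqrt_step x = Sup {y. y * y \<le> x}"

definition succ_of :: "'o::wellorder \<Rightarrow> 'o \<Rightarrow> bool" where
  "succ_of \<beta> \<alpha> \<longleftrightarrow> \<beta> < \<alpha> \<and> \<not> (\<exists>\<gamma>. \<beta> < \<gamma> \<and> \<gamma> < \<alpha>)"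

lemma succ_of_unique: "succ_of \<beta> \<alpha> \<Longrightarrow> succ_of \<gamma> \<alpha> \<Longrightarrow> \<gamma> = \<beta>"
  unfolding succ_of_def by (metis linorder_neqE)

lemma the_succ_of: "succ_of \<beta> \<alpha> \<Longrightarrow> (THE \<beta>. succ_of \<beta> \<alpha>) = \<beta>"
  by (blast intro: succ_of_unique)

text \<open>The transfinite sequence \<open>x\<^sub>(\<^sub>\<alpha>\<^sub>)\<close>. An ordinal is given as an element \<open>\<alpha>\<close> of an arbitrary
  well-ordered type, standing for the order type of \<open>{..<\<alpha>}\<close>; thus \<open>n :: nat\<close> is the finite
  ordinal \<open>n\<close>. The recursion equations are \<open>trans_seq_zero\<close>, \<open>trans_seq_succ\<close> and
  \<open>trans_seq_limit\<close> below.\<close>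

function trans_seq :: "'a::complete_mult_lattice \<Rightarrow> 'o::wellorder \<Rightarrow> 'a" where
  "trans_seq x \<alpha> =
     (if \<forall>\<beta>. \<alpha> \<le> \<beta> then x
      else if \<exists>\<beta>. succ_of \<beta> \<alpha> then sqrt_step (trans_seq x (THE \<beta>. succ_of \<beta> \<alpha>))
      else SUP \<beta>\<in>{..<\<alpha>}. trans_seq x \<beta>)"
  by auto
termination
  by (relation "inv_image {(a, b). a < b} snd")
    (auto simp: the_succ_of intro: wf wf_inv_image, simp add: succ_of_def)

declare trans_seq.simps [simp del]

lemma trans_seq_zero: "(\<forall>\<beta>. \<alpha> \<le> \<beta>) \<Longrightarrow> trans_seq x \<alpha> = x"
  by (simp add: trans_seq.simps)

lemma trans_seq_succ:
  assumes "succ_of \<beta> \<alpha>"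
  shows "trans_seq x \<alpha> = sqrt_step (trans_seq x \<beta>)"
proof -
  have "\<not> (\<forall>\<beta>. \<alpha> \<le> \<beta>)"
    using assms by (auto simp: succ_of_def not_le)
  with assms show ?thesis
    by (subst trans_seq.simps) (auto simp: the_succ_of)
qed

lemma trans_seq_limit:
  assumes "\<not> (\<forall>\<beta>. \<alpha> \<le> \<beta>)" "\<not> (\<exists>\<beta>. succ_of \<beta> \<alpha>)"
  shows "trans_seq x \<alpha> = (SUP \<beta>\<in>{..<\<alpha>}. trans_seq x \<beta>)"
  using assms by (subst trans_seq.simps) (metis (no_types))

lemma trans_seq_nat_0: "trans_seq x (0::nat) = x"
  by (simp add: trans_seq_zero)

lemma trans_seq_nat_Suc: "trans_seq x (Suc n) = sqrt_step (trans_seq x n)"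
  by (rule trans_seq_succ) (auto simp: succ_of_def)

text \<open>HOL has no type of all ordinals. The type \<open>'a ordinal\<close> consists of all ordinals below the
  initial ordinal of the cardinal \<open>2 ^ (|'a| + \<aleph>\<^sub>0)\<close>. As this cardinal exceeds that of \<open>'a\<close>, every
  transfinite sequence in \<open>'a\<close> as above becomes stationary within this range, so the join in
  \<open>Solv\<close> is the join over all ordinals; see \<open>trans_seq_le_Solv\<close>.\<close>

typedef 'a ordinal = "UNIV :: ('a + nat) set set"
  by simp

instantiation ordinal :: (type) wellorder
begin

definition less_eq_ordinal :: "'a ordinal \<Rightarrow> 'a ordinal \<Rightarrow> bool" where
  "less_eq_ordinal \<alpha> \<beta> \<longleftrightarrow> (Rep_ordinal \<alpha>, Rep_ordinal \<beta>) \<in> card_of UNIV"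

definition less_ordinal :: "'a ordinal \<Rightarrow> 'a ordinal \<Rightarrow> bool" where
  "less_ordinal \<alpha> \<beta> \<longleftrightarrow> (Rep_ordinal \<alpha>, Rep_ordinal \<beta>) \<in> card_of UNIV \<and> \<alpha> \<noteq> \<beta>"

instance
proof -
  let ?r = "card_of (UNIV :: ('a + nat) set set)"
  have wo: "well_order_on UNIV ?r"
    by (rule card_of_well_order_on)
  then have refl: "refl ?r" and trans: "trans ?r" and anti: "antisym ?r" and total: "total ?r"
    and wf: "wf (?r - Id)"
    by (auto simp: well_order_on_def linear_order_on_def partial_order_on_def preorder_on_def)
  have less: "(Rep_ordinal \<alpha>, Rep_ordinal \<beta>) \<in> ?r - Id \<longleftrightarrow> \<alpha> < \<beta>" for \<alpha> \<beta> :: "'a ordinal"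
    by (auto simp: less_eq_ordinal_def less_ordinal_def Rep_ordinal_inject)
  show "OFCLASS('a ordinal, wellorder_class)"
  proof
    fix \<alpha> \<beta> \<gamma> :: "'a ordinal"
    show "\<alpha> < \<beta> \<longleftrightarrow> \<alpha> \<le> \<beta> \<and> \<not> \<beta> \<le> \<alpha>"
      using anti refl unfolding less_ordinal_def less_eq_ordinal_def antisym_def refl_on_def
      by (metis Rep_ordinal_inject UNIV_I)
    show "\<alpha> \<le> \<alpha>"
      using refl by (auto simp: less_eq_ordinal_def refl_on_def)
    show "\<alpha> \<le> \<beta> \<Longrightarrow> \<beta> \<le> \<gamma> \<Longrightarrow> \<alpha> \<le> \<gamma>"
      using trans unfolding less_eq_ordinal_def by (blast dest: transD)
    show "\<alpha> \<le> \<beta> \<Longrightarrow> \<beta> \<le> \<alpha> \<Longrightarrow> \<alpha> = \<beta>"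
      using anti unfolding less_eq_ordinal_def by (metis Rep_ordinal_inject antisymD)
    show "\<alpha> \<le> \<beta> \<or> \<beta> \<le> \<alpha>"
      using total refl unfolding less_eq_ordinal_def total_on_def refl_on_def by (metis UNIV_I)
  next
    fix P :: "'a ordinal \<Rightarrow> bool" and \<alpha>
    assume step: "\<And>\<alpha>. (\<And>\<beta>. \<beta> < \<alpha> \<Longrightarrow> P \<beta>) \<Longrightarrow> P \<alpha>"
    have "wf (inv_image (?r - Id) (Rep_ordinal :: 'a ordinal \<Rightarrow> _))"
      by (rule wf_inv_image) (rule wf)
    then show "P \<alpha>"
      by (induction \<alpha> rule: wf_induct_rule) (use step less in \<open>auto simp: in_inv_image\<close>)
  qed
qed

end

definition Solv :: "'a::complete_mult_lattice \<Rightarrow> 'a" where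
  "Solv x = (SUP \<alpha> :: 'a ordinal. trans_seq x \<alpha>)"


lemma sqrt_step_ge: "x \<le> sqrt_step x"
proof -
  have "x * x \<le> x"
    using mult_le_inf[of x x] by simp
  then show ?thesis
    unfolding sqrt_step_def by (intro Sup_upper) simp
qed

lemma sqrt_step_mono: "x \<le> y \<Longrightarrow> sqrt_step x \<le> sqrt_step y"
  unfolding sqrt_step_def by (intro Sup_subset_mono) auto

lemma trans_seq_cases:
  fixes \<alpha> :: "'o::wellorder"
  obtains (zero) "\<forall>\<beta>. \<alpha> \<le> \<beta>" | (succ) \<beta> where "succ_of \<beta> \<alpha>"
    | (limit) "\<not> (\<forall>\<beta>. \<alpha> \<le> \<beta>)" "\<not> (\<exists>\<beta>. succ_of \<beta> \<alpha>)"
  by blast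

lemma trans_seq_mono:
  fixes \<alpha> \<beta> :: "'o::wellorder"
  assumes "\<alpha> \<le> \<beta>"
  shows "trans_seq x \<alpha> \<le> trans_seq x \<beta>"
  using assms
proof (induction \<beta> rule: less_induct)
  case (less \<beta>)
  show ?case
  proof (cases "\<alpha> = \<beta>")
    case False
    with less.prems have lt: "\<alpha> < \<beta>" by simp
    show ?thesis
    proof (cases \<beta> rule: trans_seq_cases)
      case zero
      with lt show ?thesis by (meson leD)
    next
      case (succ \<gamma>)
      then have "\<gamma> < \<beta>" "\<alpha> \<le> \<gamma>"
        using lt by (auto simp: succ_of_def not_less[symmetric])
      then have "trans_seq x \<alpha> \<le> trans_seq x \<gamma>"
        by (rule less.IH)
      also have "\<dots> \<le> trans_seq x \<beta>"
        by (simp add: trans_seq_succ[OF succ] sqrt_step_ge)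
      finally show ?thesis .
    next
      case limit
      with lt show ?thesis
        by (auto simp: trans_seq_limit intro: SUP_upper)
    qed
  qed simp
qed

lemma trans_seq_le_fixpoint:
  fixes \<alpha> :: "'o::wellorder"
  assumes "x \<le> z" "sqrt_step z \<le> z"
  shows "trans_seq x \<alpha> \<le> z"
proof (induction \<alpha> rule: less_induct)
  case (less \<alpha>)
  show ?case
  proof (cases \<alpha> rule: trans_seq_cases)
    case zero
    with assms show ?thesis by (simp add: trans_seq_zero)
  next
    case (succ \<beta>)
    then have "trans_seq x \<beta> \<le> z"
      using less by (simp add: succ_of_def)
    then show ?thesis
      using assms(2) sqrt_step_mono by (fastforce simp: trans_seq_succ[OF succ] intro: order_trans)
  next
    case limit
    with less show ?thesis by (auto simp: trans_seq_limit intro: SUP_least)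
  qed
qed

lemma trans_seq_stationary:
  fixes x :: "'a::complete_mult_lattice"
  shows "\<exists>\<alpha> :: 'a ordinal. sqrt_step (trans_seq x \<alpha>) = trans_seq x \<alpha>"
proof -
  have "\<not> inj (trans_seq x :: 'a ordinal \<Rightarrow> 'a)"
  proof
    assume inj: "inj (trans_seq x :: 'a ordinal \<Rightarrow> 'a)"
    define f where "f = (\<lambda>A :: ('a + nat) set. Inl (trans_seq x (Abs_ordinal A)) :: 'a + nat)"
    have "inj f"
    proof (rule injI)
      fix A B
      assume "f A = f B"
      then have "(Abs_ordinal A :: 'a ordinal) = Abs_ordinal B"
        unfolding f_def by (intro injD[OF inj]) (rule sum.inject(1)[THEN iffD1])
      then show "A = B"
        by (simp add: Abs_ordinal_inject)
    qed
    then have "surj (inv f)"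
      by (rule inj_imp_surj_inv)
    then show False
      using Cantors_theorem[of UNIV] by (metis Pow_UNIV)
  qed
  then obtain \<alpha> \<beta> :: "'a ordinal" where "\<alpha> \<noteq> \<beta>" "trans_seq x \<alpha> = trans_seq x \<beta>"
    by (auto simp: inj_on_def)
  then obtain \<alpha> \<beta> :: "'a ordinal" where lt: "\<alpha> < \<beta>" and eq: "trans_seq x \<alpha> = trans_seq x \<beta>"
    by (metis linorder_neqE)
  define \<gamma> where "\<gamma> = (LEAST \<gamma>. \<alpha> < \<gamma>)"
  have "\<alpha> < \<gamma>"
    unfolding \<gamma>_def using lt by (rule LeastI)
  then have succ: "succ_of \<alpha> \<gamma>"
    unfolding succ_of_def by (auto simp: \<gamma>_def dest: not_less_Least)
  have "\<gamma> \<le> \<beta>"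
    unfolding \<gamma>_def using lt by (rule Least_le)
  then have "sqrt_step (trans_seq x \<alpha>) \<le> trans_seq x \<beta>"
    using trans_seq_mono[of \<gamma> \<beta> x] by (simp add: trans_seq_succ[OF succ])
  with eq show ?thesis
    by (metis antisym sqrt_step_ge)
qed

lemma trans_seq_le_Solv:
  fixes x :: "'a::complete_mult_lattice" and \<delta> :: "'o::wellorder"
  shows "trans_seq x \<delta> \<le> Solv x"
proof -
  obtain \<alpha> :: "'a ordinal" where fixed: "sqrt_step (trans_seq x \<alpha>) = trans_seq x \<alpha>"
    using trans_seq_stationary by blast
  obtain \<zeta> :: "'a ordinal" where zero: "\<forall>\<beta>. \<zeta> \<le> \<beta>"
    using Least_le[of "\<lambda>_. True"] by blast
  have "x = trans_seq x \<zeta>"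
    by (simp add: trans_seq_zero[OF zero])
  also have "\<dots> \<le> trans_seq x \<alpha>"
    using zero by (intro trans_seq_mono) blast
  finally have "trans_seq x \<delta> \<le> trans_seq x \<alpha>"
    using fixed by (intro trans_seq_le_fixpoint) auto
  also have "\<dots> \<le> Solv x"
    unfolding Solv_def by (rule SUP_upper) simp
  finally show ?thesis .
qed

end

theory Submission
  imports Defs
begin

text \<open>Only \<open>\<surd>y \<le> solv y\<close> needs work. If a compact \<open>c \<le> \<surd>y\<close> were not \<open>y\<close>-solvable, then all
  \<open>c\<^sup>(\<^sup>n\<^sup>)\<close> would be compact and not below \<open>y\<close>, so by Zorn's lemma there is a \<open>p \<ge> y\<close> maximal among the
  elements above none of the \<open>c\<^sup>(\<^sup>n\<^sup>)\<close>. By distributivity \<open>(p \<squnion> a)(p \<squnion> b) \<le> p \<squnion> ab\<close>, hence \<open>p\<close> is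
  prime, contradicting \<open>c \<le> \<surd>y \<le> p\<close>. Conversely, \<open>\<surd>y\<close> bounds \<open>Solv y\<close> because it is closed under
  \<open>sqrt_step\<close>, and it bounds \<open>loc_solv y\<close> because the derived series of a compact element
  that avoids a prime also avoids it.\<close>

section \<open>Derived series against the finite stages of the transfinite sequence\<close>

lemma trans_seq_sqrt_step: "trans_seq (sqrt_step y) n = trans_seq y (Suc n)"
  by (induction n) (simp_all add: trans_seq_nat_0 trans_seq_nat_Suc)

text \<open>The outermost squaring of \<open>derived x (Suc n)\<close> is absorbed by passing from
  \<open>y\<close> to \<open>sqrt_step y\<close>. The induction therefore needs \<open>y\<close>
  arbitrary, and \<open>trans_seq_sqrt_step\<close> turns the shifted start back into a shifted
  index.\<close>

lemma derived_le_imp_le_trans_seq: "derived x n \<le> y \<Longrightarrow> x \<le> trans_seq y n"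
proof (induction n arbitrary: y)
  case 0
  then show ?case by (simp add: trans_seq_nat_0)
next
  case (Suc n)
  then have "derived x n \<le> sqrt_step y"
    unfolding sqrt_step_def by (intro Sup_upper) simp
  then have "x \<le> trans_seq (sqrt_step y) n"
    by (rule Suc.IH)
  then show ?case
    by (simp only: trans_seq_sqrt_step)
qed

lemma solv_le_Solv: "solv y \<le> Solv y"
  unfolding solv_def solvable_def
  by (rule Sup_least) (auto intro: order_trans[OF derived_le_imp_le_trans_seq trans_seq_le_Solv])

lemma derived_antimono:
  assumes "m \<le> n"
  shows "derived x n \<le> derived x m"
proof (rule lift_Suc_antimono_le[OF _ assms])
  show "derived x (Suc n) \<le> derived x n" for n
    using mult_le_inf[of "derived x n" "derived x n"] by simp
qed

section \<open>The radical as a meet of primes\<close>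

lemma radical_eq_Inf_primes: "radical x = Inf {p. prime_element p \<and> x \<le> p}"
  unfolding radical_def
proof (rule Least_equality)
  show "radical_element (Inf {p. prime_element p \<and> x \<le> p}) \<and> x \<le> Inf {p. prime_element p \<and> x \<le> p}"
  proof
    show "radical_element (Inf {p. prime_element p \<and> x \<le> p})"
      unfolding radical_element_def
      by (rule exI[of _ "{p. prime_element p \<and> x \<le> p}"]) simp
    show "x \<le> Inf {p. prime_element p \<and> x \<le> p}"
      by (rule Inf_greatest) simp
  qed
next
  fix r
  assume "radical_element r \<and> x \<le> r"
  then obtain P where P: "\<And>p. p \<in> P \<Longrightarrow> prime_element p" "r = Inf P" "x \<le> Inf P"
    unfolding radical_element_def by auto
  \<comment> \<open>A radical element above \<open>x\<close> is thus a meet over a subfamily of the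
    primes above \<open>x\<close>, so the meet over the whole family lies below it.\<close>
  have "x \<le> p" if "p \<in> P" for p
    using P(3) Inf_lower[OF that] by (rule order_trans)
  with P(1) have "P \<subseteq> {p. prime_element p \<and> x \<le> p}"
    by blast
  then show "Inf {p. prime_element p \<and> x \<le> p} \<le> r"
    unfolding P(2) by (rule Inf_superset_mono)
qed

lemma radical_ge: "x \<le> radical x"
  unfolding radical_eq_Inf_primes by (blast intro: Inf_greatest)

lemma radical_le_prime: "prime_element p \<Longrightarrow> x \<le> p \<Longrightarrow> radical x \<le> p"
  unfolding radical_eq_Inf_primes by (blast intro: Inf_lower)

lemma le_radicalI: "(\<And>p. prime_element p \<Longrightarrow> y \<le> p \<Longrightarrow> x \<le> p) \<Longrightarrow> x \<le> radical y"
  unfolding radical_eq_Inf_primes by (blast intro: Inf_greatest)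

lemma prime_elementD: "prime_element p \<Longrightarrow> x * y \<le> p \<Longrightarrow> x \<le> p \<or> y \<le> p"
  unfolding prime_element_def by blast

lemma prime_derived_le: "prime_element p \<Longrightarrow> derived x n \<le> p \<Longrightarrow> x \<le> p"
  by (induction n) (auto dest: prime_elementD)

lemma Solv_le_radical: "Solv y \<le> radical y"
  unfolding Solv_def
proof (intro SUP_least trans_seq_le_fixpoint radical_ge)
  show "sqrt_step (radical y) \<le> radical y"
    unfolding sqrt_step_def
    \<comment> \<open>If \<open>z * z \<le> radical y\<close>, then \<open>z * z\<close> lies below
      every prime above \<open>y\<close>, hence so does \<open>z\<close>.\<close>
    by (blast intro: Sup_least le_radicalI dest: prime_elementD order_trans[OF _ radical_le_prime])
qed

section \<open>Distributivity, compactness and local solvability\<close>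

lemma mult_mono_distributive:
  fixes a b c d :: "'a::complete_mult_lattice"
  assumes "mult_distributive TYPE('a)" "a \<le> b" "c \<le> d"
  shows "a * c \<le> b * d"
proof -
  have "a * c \<le> a * d"
    using assms(1,3) unfolding mult_distributive_def by (metis sup.absorb2 sup_ge1)
  also have "\<dots> \<le> b * d"
    using assms(1,2) unfolding mult_distributive_def by (metis sup.absorb2 sup_ge1)
  finally show ?thesis .
qed

text \<open>After expansion, each product with a factor \<open>p\<close> lies below \<open>p\<close>
  by \<open>mult_le_inf\<close>, which leaves only \<open>a * b\<close>.\<close>

lemma sup_mult_sup_le:
  fixes a b p :: "'a::complete_mult_lattice"
  assumes "mult_distributive TYPE('a)"
  shows "sup p a * sup p b \<le> sup p (a * b)"
proof -
  have "sup p a * sup p b = sup (p * sup p b) (sup (a * p) (a * b))"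
    using assms unfolding mult_distributive_def by metis
  moreover have "p * sup p b \<le> p" "a * p \<le> p"
    using mult_le_inf by (auto intro: order_trans)
  ultimately show ?thesis
    by (simp add: le_supI1)
qed

lemma compact_derived:
  fixes c :: "'a::complete_mult_lattice"
  assumes "weak_Kaplansky TYPE('a)" "compact_element c"
  shows "compact_element (derived c n)"
  using assms by (induction n) (auto simp: weak_Kaplansky_def)

lemma algebraic_le_by_compact:
  fixes x y :: "'a::complete_lattice"
  assumes "algebraic_lattice TYPE('a)" "\<And>c. compact_element c \<Longrightarrow> c \<le> x \<Longrightarrow> c \<le> y"
  shows "x \<le> y"
proof -
  obtain K where "\<forall>k\<in>K. compact_element k" "x = Sup K"
    using assms(1) unfolding algebraic_lattice_def by blast
  then show ?thesis
    using assms(2) by (auto intro: Sup_least Sup_upper)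
qed

lemma solv_le_loc_solv:
  fixes y :: "'a::complete_mult_lattice"
  assumes "mult_distributive TYPE('a)"
  shows "solv y \<le> loc_solv y"
  unfolding solv_def loc_solv_def
proof (intro Sup_subset_mono subsetI CollectI)
  fix x
  assume "x \<in> {x. solvable y x}"
  then obtain n where n: "derived x n \<le> y"
    by (auto simp: solvable_def)
  have "c n \<le> y" if c: "c 0 \<le> x" "\<forall>n. c (Suc n) \<le> c n * c n" for c
  proof -
    have "c k \<le> derived x k" for k
      by (induction k) (use c in \<open>auto intro: order_trans mult_mono_distributive[OF assms]\<close>)
    with n show ?thesis by (blast intro: order_trans)
  qed
  then show "locally_solvable y x"
    unfolding locally_solvable_def by blast
qed

lemma loc_solv_le_radical:
  fixes y :: "'a::complete_mult_lattice"
  assumes "algebraic_lattice TYPE('a)" "weak_Kaplansky TYPE('a)"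
  shows "loc_solv y \<le> radical y"
  unfolding loc_solv_def
proof (rule Sup_least, rule le_radicalI, rule algebraic_le_by_compact[OF assms(1)])
  fix x p c
  assume "x \<in> {x. locally_solvable y x}" and p: "prime_element p" "y \<le> p"
    and c: "compact_element c" "c \<le> x"
  then have "\<forall>d. (\<forall>n. compact_element (d n)) \<and> d 0 \<le> x \<and> (\<forall>n. d (Suc n) \<le> d n * d n)
      \<longrightarrow> (\<exists>n. d n \<le> y)"
    by (simp add: locally_solvable_def)
  \<comment> \<open>The derived series of \<open>c\<close> is itself an admissible sequence: the
    weak Kaplansky condition keeps all its terms compact.\<close>
  from this[THEN spec, of "derived c"] obtain n where "derived c n \<le> y"
    using compact_derived[OF assms(2) c(1)] c(2) by auto
  then have "derived c n \<le> p"
    using p(2) by (rule order_trans)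
  with p(1) show "c \<le> p"
    by (rule prime_derived_le)
qed

section \<open>Maximal elements avoiding a set of compact elements\<close>

lemma chain_finite_Sup_le:
  fixes C :: "'a::complete_lattice set"
  assumes "finite F" "F \<subseteq> C" "C \<noteq> {}" "\<And>a b. a \<in> C \<Longrightarrow> b \<in> C \<Longrightarrow> a \<le> b \<or> b \<le> a"
  shows "\<exists>z\<in>C. Sup F \<le> z"
  using assms(1,2)
proof (induction F rule: finite_induct)
  case empty
  with assms(3) show ?case by auto
next
  case (insert a F)
  then obtain z where "z \<in> C" "Sup F \<le> z" by auto
  with insert.prems assms(4)[of a z] show ?case
    by (auto intro: order_trans)
qed

text \<open>A finite subset of a nonempty chain is bounded by a member of the chain. This is how a
  chain of elements avoiding \<open>c\<close> has a join that avoids \<open>c\<close>, as Zorn's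
  lemma requires.\<close>

lemma compact_le_chain_Sup:
  fixes C :: "'a::complete_lattice set"
  assumes "compact_element c" "c \<le> Sup C" "C \<noteq> {}"
    and "\<And>a b. a \<in> C \<Longrightarrow> b \<in> C \<Longrightarrow> a \<le> b \<or> b \<le> a"
  shows "\<exists>z\<in>C. c \<le> z"
  using assms chain_finite_Sup_le[of _ C] unfolding compact_element_def
  by (meson order_trans)

lemma ex_maximal_avoiding_compacts:
  fixes y :: "'a::complete_lattice"
  assumes "\<And>k. k \<in> K \<Longrightarrow> compact_element k" "\<And>k. k \<in> K \<Longrightarrow> \<not> k \<le> y"
  obtains p where "y \<le> p" "\<And>k. k \<in> K \<Longrightarrow> \<not> k \<le> p" "\<And>z. p < z \<Longrightarrow> \<exists>k\<in>K. k \<le> z"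
proof -
  define A where "A = {z. y \<le> z \<and> (\<forall>k\<in>K. \<not> k \<le> z)}"
  have "\<exists>p\<in>A. \<forall>z\<in>A. p \<le> z \<longrightarrow> z = p"
  proof (rule predicate_Zorn)
    show "partial_order_on A (relation_of (\<le>) A)"
      by (rule partial_order_on_relation_ofI) auto
  next
    fix C
    assume "C \<in> Chains (relation_of (\<le>) A)"
    then have CA: "C \<subseteq> A" and chain: "\<And>a b. a \<in> C \<Longrightarrow> b \<in> C \<Longrightarrow> a \<le> b \<or> b \<le> a"
      by (auto simp: Chains_def relation_of_def)
    show "\<exists>u\<in>A. \<forall>a\<in>C. a \<le> u"
    proof (cases "C = {}")
      case True
      have "y \<in> A"
        using assms(2) by (simp add: A_def)
      with True show ?thesis by blast
    next
      case False
      then have "y \<le> Sup C"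
        using CA by (auto simp: A_def intro: Sup_upper2)
      moreover have "\<not> k \<le> Sup C" if "k \<in> K" for k
        using compact_le_chain_Sup[OF assms(1)[OF that] _ False chain] CA that
        by (auto simp: A_def)
      ultimately have "Sup C \<in> A"
        by (simp add: A_def)
      then show ?thesis by (blast intro: Sup_upper)
    qed
  qed
  then obtain p where "p \<in> A" and max: "\<And>z. z \<in> A \<Longrightarrow> p \<le> z \<Longrightarrow> z = p"
    by blast
  then have p: "y \<le> p" "\<And>k. k \<in> K \<Longrightarrow> \<not> k \<le> p"
    by (auto simp: A_def)
  moreover have "\<exists>k\<in>K. k \<le> z" if "p < z" for z
    using that max[of z] p(1) by (force simp: A_def)
  ultimately show thesis by (rule that)
qed

section \<open>Primality of the maximal element and the equalities\<close>

lemma maximal_avoiding_derived_prime: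
  fixes c p :: "'a::complete_mult_lattice"
  assumes "mult_distributive TYPE('a)"
    and avoid: "\<And>n. \<not> derived c n \<le> p" and max: "\<And>z. p < z \<Longrightarrow> \<exists>n. derived c n \<le> z"
  shows "prime_element p"
  unfolding prime_element_def
proof (intro conjI allI impI)
  show "p \<noteq> top"
    using avoid by auto
next
  fix a b
  assume ab: "a * b \<le> p"
  show "a \<le> p \<or> b \<le> p"
  proof (rule ccontr)
    assume "\<not> (a \<le> p \<or> b \<le> p)"
    then have "p < sup p a" "p < sup p b"
      by (auto simp: less_le_not_le)
    then obtain m n where "derived c m \<le> sup p a" "derived c n \<le> sup p b"
      using max by blast
    \<comment> \<open>The series decreases, so one common term lies below both joins. Its square is
      the next term, which is then forced below \<open>p\<close>.\<close>
    then have "derived c (max m n) \<le> sup p a" "derived c (max m n) \<le> sup p b"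
      by (meson derived_antimono max.cobounded1 max.cobounded2 order_trans)+
    then have "derived c (Suc (max m n)) \<le> sup p a * sup p b"
      by (simp add: mult_mono_distributive[OF assms(1)])
    also have "\<dots> \<le> sup p (a * b)"
      by (rule sup_mult_sup_le[OF assms(1)])
    also have "\<dots> = p"
      using ab by (rule sup_absorb1)
    finally show False
      using avoid by blast
  qed
qed

lemma radical_le_solv:
  fixes y :: "'a::complete_mult_lattice"
  assumes "algebraic_lattice TYPE('a)" "mult_distributive TYPE('a)" "weak_Kaplansky TYPE('a)"
  shows "radical y \<le> solv y"
proof (rule algebraic_le_by_compact[OF assms(1)])
  fix c
  assume c: "compact_element c" "c \<le> radical y"
  have "solvable y c"
  proof (rule ccontr)
    assume "\<not> solvable y c"
    then have "\<not> k \<le> y" if "k \<in> range (derived c)" for k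
      using that by (auto simp: solvable_def)
    moreover have "compact_element k" if "k \<in> range (derived c)" for k
      using that compact_derived[OF assms(3) c(1)] by auto
    ultimately obtain p where p: "y \<le> p" "\<And>k. k \<in> range (derived c) \<Longrightarrow> \<not> k \<le> p"
        "\<And>z. p < z \<Longrightarrow> \<exists>k\<in>range (derived c). k \<le> z"
      using ex_maximal_avoiding_compacts[of "range (derived c)" y] by metis
    have "prime_element p"
      by (rule maximal_avoiding_derived_prime[OF assms(2)]) (use p(2,3) in auto)
    then have "radical y \<le> p"
      using p(1) by (rule radical_le_prime)
    with c(2) have "c \<le> p"
      by (rule order_trans)
    \<comment> \<open>The series starts at \<open>c\<close> itself, so avoiding all its terms
      includes avoiding \<open>c\<close>.\<close>
    moreover have "\<not> derived c 0 \<le> p"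
      by (rule p(2)) (rule rangeI)
    ultimately show False by simp
  qed
  then show "c \<le> solv y"
    unfolding solv_def by (blast intro: Sup_upper)
qed

theorem theorem7p4:
  shows "((\<forall>(x :: 'a::complete_mult_lattice) (y :: 'a) (n :: nat).
              derived x n \<le> y \<longrightarrow> x \<le> trans_seq y n)
          \<and> (\<forall>y :: 'a. solv y \<le> Solv y))
       \<and> (algebraic_lattice TYPE('a) \<and> mult_distributive TYPE('a) \<and> weak_Kaplansky TYPE('a)
          \<longrightarrow> (\<forall>y :: 'a. Solv y = solv y \<and> solv y = loc_solv y \<and> loc_solv y = radical y))"
proof (intro conjI impI)
  show "\<forall>(x :: 'a) y n. derived x n \<le> y \<longrightarrow> x \<le> trans_seq y n"
    by (simp add: derived_le_imp_le_trans_seq)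
  show "\<forall>y :: 'a. solv y \<le> Solv y"
    by (simp add: solv_le_Solv)
next
  assume "algebraic_lattice TYPE('a) \<and> mult_distributive TYPE('a) \<and> weak_Kaplansky TYPE('a)"
  then have L: "algebraic_lattice TYPE('a)" "mult_distributive TYPE('a)" "weak_Kaplansky TYPE('a)"
    by blast+
  show "\<forall>y :: 'a. Solv y = solv y \<and> solv y = loc_solv y \<and> loc_solv y = radical y"
  proof
    fix y :: 'a
    note solv_le_Solv[of y] Solv_le_radical[of y] radical_le_solv[OF L, of y]
      solv_le_loc_solv[OF L(2), of y] loc_solv_le_radical[OF L(1,3), of y]
    then show "Solv y = solv y \<and> solv y = loc_solv y \<and> loc_solv y = radical y"
      \<comment> \<open>The inequalities close two cycles through
        \<open>radical y \<le> solv y\<close>: one passes through \<open>Solv y\<close>, the other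
        through \<open>loc_solv y\<close>.\<close>
      by (intro conjI; order)
  qed
qed

end
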